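(* Let $\pi$ (target) and $p$ (proposal) be continuous probability densities on a general state space $\mathcal X$ ($\mathbb R^d$ or a subset of it), with $\operatorname{supp}(\pi)\subset\operatorname{supp}(p)$ and $w^\star=\sup_x \pi(x)/p(x)<\infty$. Let $P$ be the transition kernel of the Independent Metropolis-Hastings (IMH) chain with target $\pi$ and proposal $p$. Then for every integer $n\ge 1$, $$\sup_{x\in\operatorname{supp}(\pi)}\|P^n(x,\cdot)-\pi\|_{\mathrm{TV}}=\Big(1-\frac1{w^\star}\Big)^n .$$ In particular, if there exists $x^\star\in\mathcal X$ with $w(x^\star)=w^\star$, then for every $n\ge1$ $$\sup_{x\in\operatorname{supp}(\pi)}\|P^n(x,\cdot)-\pi\|_{\mathrm{TV}}=\|P^n(x^\star,\cdot)-\pi\|_{\mathrm{TV}}=\Big(1-\frac1{w^\star}\Big)^n .$$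
   Context: The general state space $\mathcal X$ is $\mathbb R^d$ or a subset of $\mathbb R^d$ (a Polish space), with its Borel $\sigma$-algebra; densities are with respect to Lebesgue measure $dy$, and $\pi$ also denotes the probability measure with density $\pi$. Here $\operatorname{supp}(f)=\{x\in\mathcal X: f(x)>0\}$. The weight function is $w(x)=\pi(x)/p(x)$ for $x\in\operatorname{supp}(p)$, and $w^\star=\sup_{x}w(x)$. The IMH chain: from the current state $x\in\operatorname{supp}(\pi)$, draw $y\sim p$ (independently of $x$) and move to $y$ with probability $\min\{w(y)/w(x),1\}$, otherwise stay at $x$. Its kernel is, for $x\in\operatorname{supp}(\pi)$ and measurable $A$, $$P(x,A)=\int_A \min\Big\{\frac{w(y)}{w(x)},1\Big\}p(y)\,dy+R(x)\mathbf 1_A(x),\qquad R(x)=\int_{\mathcal X}\Big(1-\min\Big\{\frac{w(y)}{w(x)},1\Big\}\Big)p(y)\,dy .$$ The chain is always started in (and then stays almost surely in) $\operatorname{supp}(\pi)$. $P^n$ is the $n$-step kernel, and $\|\mu-\nu\|_{\mathrm{TV}}=\sup_A|\mu(A)-\nu(A)|$. *)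

theory Defs
  imports "HOL-Probability.Probability"
begin

section \<open>State space, densities and total variation\<close>

definition polish_subset :: "'a::topological_space set \<Rightarrow> bool" where
  "polish_subset X \<longleftrightarrow>
     completely_metrizable_space (top_of_set X) \<and> second_countable (top_of_set X)"

lemma polish_subset_imp_borel:
  fixes X :: "'a::euclidean_space set"
  assumes "polish_subset X"
  shows "X \<in> sets borel"
proof -
  have "completely_metrizable_space (subtopology euclidean X)"
    using assms by (simp add: polish_subset_def)
  then have "gdelta_in euclidean X"
    using completely_metrizable_space_eq_gdelta_in[OF completely_metrizable_space_euclidean]
    by (metis subset_UNIV topspace_euclidean)
  then obtain \<U> where "countable \<U>" "\<forall>U\<in>\<U>. open U" "X = \<Inter>\<U>"
    by (auto simp: gdelta_in_alt intersection_of_def)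
  then show ?thesis
    using sets.countable_INT''[where M = borel and I = \<U> and F = "\<lambda>U. U"] by auto
qed

definition lebesgue_on_space :: "'a::euclidean_space set \<Rightarrow> 'a measure" where
  "lebesgue_on_space X = restrict_space lborel X"

definition dens_measure :: "'a::euclidean_space set \<Rightarrow> ('a \<Rightarrow> real) \<Rightarrow> 'a measure" where
  "dens_measure X f = density (lebesgue_on_space X) (\<lambda>x. ennreal (f x))"

text \<open>Nonnegativity has to be required separately, since \<^const>\<open>ennreal\<close> maps negative
  reals to zero.\<close>

definition continuous_density :: "'a::euclidean_space set \<Rightarrow> ('a \<Rightarrow> real) \<Rightarrow> bool" where
  "continuous_density X f \<longleftrightarrow>
     continuous_on X f \<and> (\<forall>x\<in>X. 0 \<le> f x) \<and> prob_space (dens_measure X f)"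

definition supp :: "'a set \<Rightarrow> ('a \<Rightarrow> real) \<Rightarrow> 'a set" where
  "supp X f = {x\<in>X. f x > 0}"

definition tv_dist :: "'a measure \<Rightarrow> 'a measure \<Rightarrow> real" where
  "tv_dist \<mu> \<nu> = (SUP A\<in>sets \<mu>. \<bar>measure \<mu> A - measure \<nu> A\<bar>)"

section \<open>The Independent Metropolis-Hastings chain\<close>

definition weight :: "('a \<Rightarrow> real) \<Rightarrow> ('a \<Rightarrow> real) \<Rightarrow> 'a \<Rightarrow> real" where
  "weight \<pi> p x = \<pi> x / p x"

definition weight_sup :: "'a set \<Rightarrow> ('a \<Rightarrow> real) \<Rightarrow> ('a \<Rightarrow> real) \<Rightarrow> real" where
  "weight_sup X \<pi> p = (SUP x\<in>supp X p. weight \<pi> p x)"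

definition acc :: "('a \<Rightarrow> real) \<Rightarrow> ('a \<Rightarrow> real) \<Rightarrow> 'a \<Rightarrow> 'a \<Rightarrow> real" where
  "acc \<pi> p x y = min (weight \<pi> p y / weight \<pi> p x) 1"

definition rejection ::
  "'a::euclidean_space set \<Rightarrow> ('a \<Rightarrow> real) \<Rightarrow> ('a \<Rightarrow> real) \<Rightarrow> 'a \<Rightarrow> ennreal" where
  "rejection X \<pi> p x =
     (\<integral>\<^sup>+ y. ennreal ((1 - acc \<pi> p x y) * p y) \<partial>lebesgue_on_space X)"

text \<open>Only starting points in \<^term>\<open>supp X \<pi>\<close> matter. At the remaining points of
  \<^term>\<open>X\<close> the weight is \<open>0\<close>, so by \<open>a / 0 = 0\<close> the formula below yields the point mass at
  \<open>x\<close>; such points are almost surely never reached from \<^term>\<open>supp X \<pi>\<close>.\<close>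

definition imh_kernel ::
  "'a::euclidean_space set \<Rightarrow> ('a \<Rightarrow> real) \<Rightarrow> ('a \<Rightarrow> real) \<Rightarrow> 'a \<Rightarrow> 'a measure" where
  "imh_kernel X \<pi> p x =
     measure_of X (sets (lebesgue_on_space X))
       (\<lambda>A. (\<integral>\<^sup>+ y\<in>A. ennreal (acc \<pi> p x y * p y) \<partial>lebesgue_on_space X)
             + rejection X \<pi> p x * indicator A x)"

text \<open>The \<open>n\<close>-step kernel
  \<open>P\<^sup>n\<^sup>+\<^sup>1(x, A) = \<integral> P\<^sup>n(y, A) P(x, dy)\<close>, on the measurable space \<open>M\<close>.\<close>

primrec kernel_power :: "'a measure \<Rightarrow> ('a \<Rightarrow> 'a measure) \<Rightarrow> nat \<Rightarrow> 'a \<Rightarrow> 'a measure" where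
  "kernel_power M K 0 x = return M x"
| "kernel_power M K (Suc n) x = K x \<bind> kernel_power M K n"

definition imh_power ::
  "'a::euclidean_space set \<Rightarrow> ('a \<Rightarrow> real) \<Rightarrow> ('a \<Rightarrow> real) \<Rightarrow> nat \<Rightarrow> 'a \<Rightarrow> 'a measure" where
  "imh_power X \<pi> p = kernel_power (lebesgue_on_space X) (imh_kernel X \<pi> p)"

section \<open>Well-definedness of the kernel\<close>

lemma sets_lebesgue_on_space: "sets (lebesgue_on_space X) = sets (restrict_space borel X)"
  unfolding lebesgue_on_space_def by (rule sets_restrict_space_cong) simp

lemma space_lebesgue_on_space [simp]: "space (lebesgue_on_space X) = X"
  by (simp add: lebesgue_on_space_def space_restrict_space)

lemma space_imh_kernel [simp]: "space (imh_kernel X \<pi> p x) = X"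
  unfolding imh_kernel_def
  by (metis space_lebesgue_on_space sets.space_closed space_measure_of)

lemma sets_imh_kernel [simp]: "sets (imh_kernel X \<pi> p x) = sets (lebesgue_on_space X)"
  unfolding imh_kernel_def
  by (metis space_lebesgue_on_space sets.sets_measure_of_eq)

lemma measurable_continuous_density:
  assumes "continuous_density X f"
  shows "f \<in> borel_measurable (lebesgue_on_space X)"
proof -
  have "f \<in> borel_measurable (restrict_space borel X)"
    using assms by (auto simp: continuous_density_def intro: borel_measurable_continuous_on_restrict)
  then show ?thesis
    using measurable_cong_sets[OF sets_lebesgue_on_space refl] by blast
qed

lemma measurable_weight:
  assumes "continuous_density X \<pi>" "continuous_density X p"
  shows "weight \<pi> p \<in> borel_measurable (lebesgue_on_space X)"
  using assms[THEN measurable_continuous_density] unfolding weight_def[abs_def] by measurable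

lemma emeasure_imh_kernel:
  assumes "continuous_density X \<pi>" "continuous_density X p" "A \<in> sets (lebesgue_on_space X)"
  shows "emeasure (imh_kernel X \<pi> p x) A =
    (\<integral>\<^sup>+ y\<in>A. ennreal (acc \<pi> p x y * p y) \<partial>lebesgue_on_space X)
      + rejection X \<pi> p x * indicator A x"
    (is "_ = ?\<mu> A")
proof -
  let ?L = "lebesgue_on_space X"
  note [measurable] = measurable_weight[OF assms(1,2)] measurable_continuous_density[OF assms(2)]
  have acc [measurable]: "(\<lambda>y. ennreal (acc \<pi> p x y * p y)) \<in> borel_measurable ?L"
    unfolding acc_def by measurable
  have eq: "?\<mu> B = emeasure (density ?L (\<lambda>y. ennreal (acc \<pi> p x y * p y))) B
      + rejection X \<pi> p x * emeasure (return ?L x) B" if "B \<in> sets ?L" for B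
    using that by (simp add: emeasure_density)
  have "countably_additive (sets ?L) ?\<mu>"
  proof (rule countably_additiveI)
    fix F :: "nat \<Rightarrow> 'a set"
    assume F: "range F \<subseteq> sets ?L" "disjoint_family F" "\<Union> (range F) \<in> sets ?L"
    let ?D = "density ?L (\<lambda>y. ennreal (acc \<pi> p x y * p y))"
    have Fi: "F i \<in> sets ?L" for i using F(1) by auto
    have "(\<Sum>i. ?\<mu> (F i)) = (\<Sum>i. emeasure ?D (F i))
        + rejection X \<pi> p x * (\<Sum>i. emeasure (return ?L x) (F i))"
      by (simp add: eq[OF Fi] suminf_add[symmetric] del: emeasure_return)
    also have "\<dots> = ?\<mu> (\<Union> (range F))"
      using F by (simp add: eq suminf_emeasure del: emeasure_return)
    finally show "(\<Sum>i. ?\<mu> (F i)) = ?\<mu> (\<Union> (range F))" .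
  qed
  then show ?thesis
    unfolding imh_kernel_def using assms(3) sets.space_closed[of ?L]
    by (intro emeasure_measure_of_sigma)
       (auto simp: positive_def sets.sigma_algebra_axioms[of ?L, simplified])
qed

lemma prob_space_imh_kernel:
  assumes "continuous_density X \<pi>" "continuous_density X p" "x \<in> X"
  shows "prob_space (imh_kernel X \<pi> p x)"
proof
  let ?L = "lebesgue_on_space X"
  note [measurable] = measurable_weight[OF assms(1,2)] measurable_continuous_density[OF assms(2)]
  have nn: "0 \<le> weight \<pi> p y" if "y \<in> X" for y
    using assms(1,2) that by (auto simp: weight_def continuous_density_def)
  have "emeasure (imh_kernel X \<pi> p x) X =
      (\<integral>\<^sup>+ y\<in>X. ennreal (acc \<pi> p x y * p y) \<partial>?L)
      + (\<integral>\<^sup>+ y. ennreal ((1 - acc \<pi> p x y) * p y) \<partial>?L)"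
    using emeasure_imh_kernel[OF assms(1,2), of X x] assms(3) sets.top[of ?L]
    by (simp add: rejection_def del: sets.top)
  also have "(\<integral>\<^sup>+ y\<in>X. ennreal (acc \<pi> p x y * p y) \<partial>?L)
      = (\<integral>\<^sup>+ y. ennreal (acc \<pi> p x y * p y) \<partial>?L)"
    by (intro nn_integral_cong) auto
  also have "(\<integral>\<^sup>+ y. ennreal (acc \<pi> p x y * p y) \<partial>?L)
      + (\<integral>\<^sup>+ y. ennreal ((1 - acc \<pi> p x y) * p y) \<partial>?L)
      = (\<integral>\<^sup>+ y. ennreal (acc \<pi> p x y * p y) + ennreal ((1 - acc \<pi> p x y) * p y) \<partial>?L)"
    unfolding acc_def by (intro nn_integral_add[symmetric]) measurable
  also have "\<dots> = (\<integral>\<^sup>+ y. ennreal (p y) \<partial>?L)"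
  proof (rule nn_integral_cong)
    fix y assume "y \<in> space ?L"
    then have y: "y \<in> X" by simp
    have "0 \<le> acc \<pi> p x y" "acc \<pi> p x y \<le> 1" "0 \<le> p y"
      using nn[OF y] nn[OF assms(3)] assms(2) y by (auto simp: acc_def continuous_density_def)
    then show "ennreal (acc \<pi> p x y * p y) + ennreal ((1 - acc \<pi> p x y) * p y) = ennreal (p y)"
      by (simp add: ennreal_plus[symmetric] distrib_right[symmetric] del: ennreal_plus)
  qed
  also have "\<dots> = emeasure (dens_measure X p) (space (dens_measure X p))"
    unfolding dens_measure_def
    by (subst emeasure_density)
      (use assms(2) sets.top[of ?L] in \<open>auto intro!: nn_integral_cong measurable_continuous_density
        measurable_compose[OF _ measurable_ennreal]\<close>)
  also have "\<dots> = 1"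
    using assms(2) by (intro prob_space.emeasure_space_1) (simp add: continuous_density_def)
  finally show "emeasure (imh_kernel X \<pi> p x) (space (imh_kernel X \<pi> p x)) = 1" by simp
qed

text \<open>Measurability of the kernel, without which \<^const>\<open>bind\<close> would be meaningless.\<close>

lemma measurable_imh_kernel:
  assumes X: "polish_subset X"
    and d: "continuous_density X \<pi>" "continuous_density X p"
  shows "imh_kernel X \<pi> p \<in> lebesgue_on_space X \<rightarrow>\<^sub>M prob_algebra (lebesgue_on_space X)"
proof (rule measurable_prob_algebraI)
  let ?L = "lebesgue_on_space X"
  show "prob_space (imh_kernel X \<pi> p x)" if "x \<in> space ?L" for x
    using that prob_space_imh_kernel[OF d] by simp
  have sf: "sigma_finite_measure ?L"
    unfolding lebesgue_on_space_def
    using polish_subset_imp_borel[OF X] sigma_finite_lborel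
    by (intro sigma_finite_measure_restrict_space) auto
  interpret sigma_finite_measure ?L by (rule sf)
  note [measurable] = measurable_weight[OF d] measurable_continuous_density[OF d(2)]
  show "imh_kernel X \<pi> p \<in> ?L \<rightarrow>\<^sub>M subprob_algebra ?L"
  proof (rule measurable_subprob_algebra)
    show "subprob_space (imh_kernel X \<pi> p x)" if "x \<in> space ?L" for x
      using that prob_space_imh_kernel[OF d] by (simp add: prob_space_imp_subprob_space)
    show "(\<lambda>x. emeasure (imh_kernel X \<pi> p x) A) \<in> borel_measurable ?L"
      if [measurable]: "A \<in> sets ?L" for A
      unfolding emeasure_imh_kernel[OF d that] rejection_def acc_def by measurable
  qed simp
qed

lemma measurable_imh_power:
  assumes "polish_subset X" "continuous_density X \<pi>" "continuous_density X p"
  shows "imh_power X \<pi> p n \<in> lebesgue_on_space X \<rightarrow>\<^sub>M prob_algebra (lebesgue_on_space X)"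
proof (induction n)
  case 0
  then show ?case by (simp add: imh_power_def)
next
  case (Suc n)
  then show ?case
    using measurable_bind_prob_space[OF measurable_imh_kernel[OF assms] Suc]
    by (simp add: imh_power_def[abs_def])
qed

lemma emeasure_imh_power_Suc:
  assumes "polish_subset X" "continuous_density X \<pi>" "continuous_density X p"
    and "x \<in> X" "A \<in> sets (lebesgue_on_space X)"
  shows "emeasure (imh_power X \<pi> p (Suc n) x) A =
    (\<integral>\<^sup>+ y. emeasure (imh_power X \<pi> p n y) A \<partial>imh_kernel X \<pi> p x)"
proof -
  have "imh_power X \<pi> p n \<in> imh_kernel X \<pi> p x \<rightarrow>\<^sub>M subprob_algebra (lebesgue_on_space X)"
    using measurable_prob_algebraD[OF measurable_imh_power[OF assms(1-3)]]
    by (simp cong: measurable_cong_sets)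
  then show ?thesis
    using emeasure_bind[of "imh_kernel X \<pi> p x" "imh_power X \<pi> p n"] assms(4,5)
    by (auto simp: imh_power_def)
qed

end

theory Submission
  imports Defs
begin

text \<open>The kernel satisfies \<open>P(x, \<cdot>) \<ge> \<pi> / w\<^sup>\<star>\<close> on the support of \<open>\<pi>\<close>, because
  \<open>min (w y / w x) 1 * p y = min (\<pi> y / w x) (p y) \<ge> \<pi> y / w\<^sup>\<star>\<close>; together with the invariance
  of \<open>\<pi>\<close> (detailed balance) this gives \<open>P\<^sup>n(x, \<cdot>) \<ge> (1 - (1 - 1 / w\<^sup>\<star>)\<^sup>n) \<pi>\<close>, hence the upper bound.
  For the lower bound, \<open>\<pi>\<close> has no atoms, while \<open>P\<^sup>n(x, {x}) \<ge> R(x)\<^sup>n\<close> and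
  \<open>R(x) \<ge> 1 - 1 / w x\<close>; now let \<open>w x\<close> tend to \<open>w\<^sup>\<star>\<close>.\<close>

section \<open>Bounds on the total variation distance\<close>

lemma abs_measure_diff_le_1:
  assumes "prob_space \<mu>" "prob_space \<nu>"
  shows "\<bar>measure \<mu> A - measure \<nu> A\<bar> \<le> 1"
  using prob_space.prob_le_1[OF assms(1), of A] prob_space.prob_le_1[OF assms(2), of A]
    measure_nonneg[of \<mu> A] measure_nonneg[of \<nu> A] by linarith

lemma abs_measure_diff_le_tv_dist:
  assumes "prob_space \<mu>" "prob_space \<nu>" "A \<in> sets \<mu>"
  shows "\<bar>measure \<mu> A - measure \<nu> A\<bar> \<le> tv_dist \<mu> \<nu>"
  unfolding tv_dist_def
  \<comment> \<open>A real-valued supremum dominates its members only if the family is bounded, so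
    the bound 1 for probability measures has to be supplied.\<close>
  by (rule cSUP_upper) (use assms in \<open>auto intro!: bdd_aboveI2[of _ _ 1] abs_measure_diff_le_1\<close>)

lemma tv_dist_le:
  assumes "\<And>A. A \<in> sets \<mu> \<Longrightarrow> \<bar>measure \<mu> A - measure \<nu> A\<bar> \<le> c"
  shows "tv_dist \<mu> \<nu> \<le> c"
  unfolding tv_dist_def by (rule cSUP_least) (use assms in auto)

text \<open>Passing to the complement flips the sign of the difference of two probability measures,
  so the absolute value costs nothing. This fits a minorization, which bounds \<mu> from below
  only.\<close>

lemma tv_dist_le_one_sided:
  assumes "prob_space \<mu>" "prob_space \<nu>" "sets \<mu> = sets \<nu>"
    and le: "\<And>A. A \<in> sets \<mu> \<Longrightarrow> measure \<nu> A - measure \<mu> A \<le> c"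
  shows "tv_dist \<mu> \<nu> \<le> c"
proof (rule tv_dist_le)
  fix A assume A: "A \<in> sets \<mu>"
  have "measure \<nu> (space \<mu> - A) - measure \<mu> (space \<mu> - A) = measure \<mu> A - measure \<nu> A"
    using A assms(3) prob_space.prob_compl[OF assms(1), of A] prob_space.prob_compl[OF assms(2), of A]
    by (simp add: sets_eq_imp_space_eq[OF assms(3)])
  then show "\<bar>measure \<mu> A - measure \<nu> A\<bar> \<le> c"
    using le[OF A] le[of "space \<mu> - A"] A by simp
qed

section \<open>Weights and the target measure\<close>

locale imh =
  fixes X :: "'a::euclidean_space set" and \<pi> p :: "'a \<Rightarrow> real"
  assumes polish: "polish_subset X"
    and dens_target: "continuous_density X \<pi>" and dens_prop: "continuous_density X p"
    and supp_subset: "supp X \<pi> \<subseteq> supp X p"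
    and bdd_weight: "bdd_above (weight \<pi> p ` supp X p)"
begin

abbreviation "L \<equiv> lebesgue_on_space X"
abbreviation "target \<equiv> dens_measure X \<pi>"
abbreviation "K \<equiv> imh_kernel X \<pi> p"
abbreviation "Kn \<equiv> imh_power X \<pi> p"
abbreviation "w \<equiv> weight \<pi> p"
abbreviation "wmax \<equiv> weight_sup X \<pi> p"

lemmas [measurable] = measurable_weight[OF dens_target dens_prop]
  measurable_continuous_density[OF dens_prop] measurable_continuous_density[OF dens_target]

lemma sigma_finite_L: "sigma_finite_measure L"
  unfolding lebesgue_on_space_def
  using polish_subset_imp_borel[OF polish] sigma_finite_lborel
  by (intro sigma_finite_measure_restrict_space) auto

lemma
  assumes "x \<in> X"
  shows target_nonneg: "0 \<le> \<pi> x" and prop_nonneg: "0 \<le> p x" and weight_nonneg: "0 \<le> w x"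
  using assms dens_target dens_prop by (auto simp: continuous_density_def weight_def)

lemma target_eq_0: "x \<in> X \<Longrightarrow> p x = 0 \<Longrightarrow> \<pi> x = 0"
  using supp_subset target_nonneg[of x] by (force simp: supp_def)

text \<open>Where \<open>p\<close> vanishes the quotient is 0 by convention, and
  \<open>\<pi>\<close> vanishes as well by the inclusion of supports; hence the identity holds on
  all of \<open>X\<close>.\<close>

lemma target_eq_weight: "x \<in> X \<Longrightarrow> \<pi> x = w x * p x"
  using target_eq_0[of x] by (auto simp: weight_def)

text \<open>A point with \<open>p x = 0\<close> has weight 0 by convention and lies outside both
  supports. Positivity of \<open>w x\<close> is the form needed for dividing by \<open>w x\<close>
  and for measurability of the support.\<close>

lemma in_supp_target_iff: "x \<in> supp X \<pi> \<longleftrightarrow> x \<in> X \<and> 0 < w x"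
  using supp_subset prop_nonneg[of x] by (auto simp: supp_def weight_def zero_less_divide_iff)

text \<open>The supremum runs over \<open>supp X p\<close> only; a positive weight puts
  \<open>x\<close> into \<open>supp X \<pi>\<close> and hence into that set.\<close>

lemma weight_le_wmax: "x \<in> X \<Longrightarrow> 0 < w x \<Longrightarrow> w x \<le> wmax"
  unfolding weight_sup_def
  by (rule cSUP_upper[OF _ bdd_weight]) (use supp_subset in_supp_target_iff in blast)

lemma prob_target: "prob_space target"
  using dens_target by (simp add: continuous_density_def)

lemma prob_Kn: "x \<in> X \<Longrightarrow> prob_space (Kn n x)"
  using measurable_space[OF measurable_imh_power[OF polish dens_target dens_prop], of x n]
  by (simp add: space_prob_algebra)

lemma sets_Kn: "x \<in> X \<Longrightarrow> sets (Kn n x) = sets L"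
  using measurable_space[OF measurable_imh_power[OF polish dens_target dens_prop], of x n]
  by (simp add: space_prob_algebra)

lemma sets_target [simp, measurable_cong]: "sets target = sets L"
  by (simp add: dens_measure_def)

lemma space_target [simp]: "space target = X"
  by (simp add: dens_measure_def)

lemma nn_integral_target:
  "f \<in> borel_measurable L \<Longrightarrow> (\<integral>\<^sup>+ x. f x \<partial>target) = (\<integral>\<^sup>+ x. ennreal (\<pi> x) * f x \<partial>L)"
  unfolding dens_measure_def by (subst nn_integral_density) auto

lemma emeasure_target:
  "A \<in> sets L \<Longrightarrow> emeasure target A = (\<integral>\<^sup>+ x\<in>A. ennreal (\<pi> x) \<partial>L)"
  unfolding dens_measure_def by (subst emeasure_density) auto

lemma nn_integral_densities:
  shows "(\<integral>\<^sup>+ x. ennreal (\<pi> x) \<partial>L) = 1" and "(\<integral>\<^sup>+ x. ennreal (p x) \<partial>L) = 1"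
proof -
  have "(\<integral>\<^sup>+ x. ennreal (f x) \<partial>L) = emeasure (dens_measure X f) (space (dens_measure X f))"
    if [measurable]: "f \<in> borel_measurable L" for f
    unfolding dens_measure_def
    by (subst emeasure_density) (use sets.top[of L] in \<open>auto intro!: nn_integral_cong\<close>)
  moreover have "prob_space (dens_measure X \<pi>)" "prob_space (dens_measure X p)"
    using dens_target dens_prop by (auto simp: continuous_density_def)
  ultimately show "(\<integral>\<^sup>+ x. ennreal (\<pi> x) \<partial>L) = 1" and "(\<integral>\<^sup>+ x. ennreal (p x) \<partial>L) = 1"
    by (auto simp: prob_space.emeasure_space_1 simp del: space_target)
qed

text \<open>Integrating \<open>\<pi> \<le> wmax * p\<close> compares the total masses 1 and
  \<open>wmax\<close>. The result makes \<open>1 - 1 / wmax\<close> a number between 0 and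
  1.\<close>

lemma wmax_ge_1: "1 \<le> wmax"
proof -
  have "\<exists>x\<in>X. 0 < w x"
  proof (rule ccontr)
    assume "\<not> ?thesis"
    then have "\<pi> x = 0" if "x \<in> X" for x
      using target_eq_weight[OF that] weight_nonneg[OF that] that by force
    then have "(\<integral>\<^sup>+ x. ennreal (\<pi> x) \<partial>L) = (\<integral>\<^sup>+ x. 0 \<partial>L)"
      by (intro nn_integral_cong) auto
    then show False by (simp add: nn_integral_densities)
  qed
  \<comment> \<open>Positivity is needed first: it gives \<open>w x \<le> wmax\<close> at points of
    weight 0, which \<open>weight_le_wmax\<close> does not reach.\<close>
  then have pos: "0 < wmax" using weight_le_wmax by force
  have "1 = (\<integral>\<^sup>+ x. ennreal (\<pi> x) \<partial>L)" by (simp add: nn_integral_densities)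
  also have "\<dots> \<le> (\<integral>\<^sup>+ x. ennreal wmax * ennreal (p x) \<partial>L)"
  proof (rule nn_integral_mono)
    fix x assume "x \<in> space L"
    then have x: "x \<in> X" by simp
    have "w x \<le> wmax" using weight_le_wmax[OF x] pos by fastforce
    then have "\<pi> x \<le> wmax * p x"
      using target_eq_weight[OF x] prop_nonneg[OF x] by (simp add: mult_right_mono)
    then show "ennreal (\<pi> x) \<le> ennreal wmax * ennreal (p x)"
      using pos prop_nonneg[OF x] by (simp add: ennreal_mult[symmetric] ennreal_leI)
  qed
  also have "\<dots> = ennreal wmax"
    by (simp add: nn_integral_cmult nn_integral_densities)
  finally show ?thesis by simp
qed

section \<open>One step of the chain: minorization and support\<close>

lemma acc_times_prop:
  assumes "x \<in> X" "0 < w x" "y \<in> X"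
  shows "acc \<pi> p x y * p y = min (\<pi> y / w x) (p y)"
proof -
  have "acc \<pi> p x y * p y = min (w y / w x * p y) (1 * p y)"
    unfolding acc_def using prop_nonneg[OF assms(3)]
    by (simp add: min_mult_distrib_right)
  then show ?thesis using target_eq_weight[OF assms(3)] by simp
qed

lemma measurable_acc [measurable]: "(\<lambda>y. acc \<pi> p x y) \<in> borel_measurable L"
  unfolding acc_def by measurable

lemma acc_bounds:
  assumes "x \<in> X" "y \<in> X" shows "0 \<le> acc \<pi> p x y" "acc \<pi> p x y \<le> 1"
  using weight_nonneg assms by (auto simp: acc_def)

text \<open>Stated in the order on measures so that integrals of nonnegative functions can be
  compared; the induction over \<open>n\<close> integrates a function of the state after the first
  step.\<close>

lemma minorization:
  assumes "x \<in> supp X \<pi>"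
  shows "scale_measure (ennreal (1 / wmax)) target \<le> K x"
proof -
  have x: "x \<in> X" "0 < w x" using assms in_supp_target_iff by auto
  have "ennreal (1 / wmax) * emeasure target A \<le> emeasure (K x) A" if A[measurable]: "A \<in> sets L" for A
  proof -
    have "ennreal (1 / wmax) * emeasure target A
        = (\<integral>\<^sup>+ y. ennreal (1 / wmax) * (ennreal (\<pi> y) * indicator A y) \<partial>L)"
      by (subst nn_integral_cmult) (auto simp: emeasure_target)
    also have "\<dots> \<le> (\<integral>\<^sup>+ y\<in>A. ennreal (acc \<pi> p x y * p y) \<partial>L)"
    proof (rule nn_integral_mono)
      fix y assume "y \<in> space L"
      then have y: "y \<in> X" by simp
      have "\<pi> y / wmax \<le> \<pi> y / w x"
        using weight_le_wmax[OF x] x(2) target_nonneg[OF y] by (intro divide_left_mono) auto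
      moreover have "\<pi> y / wmax \<le> p y"
      proof -
        have "w y \<le> wmax" using weight_le_wmax[OF y] wmax_ge_1 by fastforce
        then show ?thesis
          using target_eq_weight[OF y] prop_nonneg[OF y] wmax_ge_1
          by (simp add: divide_le_eq mult.commute mult_left_mono)
      qed
      ultimately have "1 / wmax * \<pi> y \<le> acc \<pi> p x y * p y"
        using acc_times_prop[OF x y] by simp
      then show "ennreal (1 / wmax) * (ennreal (\<pi> y) * indicator A y)
          \<le> ennreal (acc \<pi> p x y * p y) * indicator A y"
        using wmax_ge_1 target_nonneg[OF y]
        by (auto simp: ennreal_mult[symmetric] ennreal_leI split: split_indicator)
    qed
    \<comment> \<open>Accepted moves alone suffice; the atom at \<open>x\<close> is
      discarded.\<close>
    also have "\<dots> \<le> emeasure (K x) A"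
      by (simp add: emeasure_imh_kernel[OF dens_target dens_prop A])
    finally show ?thesis .
  qed
  then show ?thesis by (subst le_measure) auto
qed

text \<open>A proposal of weight 0 is accepted with probability 0, and a rejection leaves the chain
  at \<open>x\<close>, whose weight is positive. Estimates valid only on the support may therefore
  be integrated against \<open>K x\<close>.\<close>

lemma AE_K_supp:
  assumes "x \<in> supp X \<pi>"
  shows "AE y in K x. y \<in> supp X \<pi>"
proof -
  let ?N = "{y \<in> space L. \<not> 0 < w y}"
  have N: "?N \<in> sets L" by measurable
  have x: "x \<in> X" "0 < w x" using assms in_supp_target_iff by auto
  have "emeasure (K x) ?N = (\<integral>\<^sup>+ y\<in>?N. ennreal (acc \<pi> p x y * p y) \<partial>L)"
    unfolding emeasure_imh_kernel[OF dens_target dens_prop N] using x(2) by simp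
  also have "\<dots> = (\<integral>\<^sup>+ y. 0 \<partial>L)"
  proof (rule nn_integral_cong)
    fix y assume "y \<in> space L"
    then have "y \<in> X" by simp
    then show "ennreal (acc \<pi> p x y * p y) * indicator ?N y = 0"
      using weight_nonneg[of y] by (auto simp: acc_def split: split_indicator)
  qed
  finally have "emeasure (K x) ?N = 0" by simp
  then show ?thesis
    using N by (intro AE_I[where N = ?N]) (auto simp: in_supp_target_iff)
qed

section \<open>Reversibility and invariance of the target\<close>

lemma detailed_balance:
  assumes "x \<in> X" "y \<in> X"
  shows "\<pi> x * (acc \<pi> p x y * p y) = \<pi> y * (acc \<pi> p y x * p x)"
proof -
  \<comment> \<open>This expression is symmetric in \<open>x\<close> and \<open>y\<close>, which is
    the whole content of detailed balance. Where \<open>w x = 0\<close>, both sides are 0.\<close>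
  have "\<pi> x * (acc \<pi> p x y * p y) = min (\<pi> x * p y) (\<pi> y * p x)" if "x \<in> X" "y \<in> X" for x y
  proof (cases "0 < w x")
    case True
    have "\<pi> x * (acc \<pi> p x y * p y) = min (\<pi> x * (\<pi> y / w x)) (\<pi> x * p y)"
      using acc_times_prop[OF that(1) True that(2)] target_nonneg[OF that(1)]
      by (simp add: min_mult_distrib_left)
    then show ?thesis
      using target_eq_weight[OF that(1)] True by (simp add: min.commute mult.commute)
  next
    case False
    then have "\<pi> x = 0"
      using target_eq_weight[OF that(1)] weight_nonneg[OF that(1)] by simp
    then show ?thesis
      using target_nonneg[OF that(2)] prop_nonneg[OF that(1)] by simp
  qed
  then show ?thesis using assms by (simp add: min.commute)
qed

text \<open>This is the total mass of \<open>K x\<close>, read off on the whole space, where the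
  point mass at \<open>x\<close> counts fully.\<close>

lemma nn_integral_acc_plus_rejection:
  assumes "x \<in> X"
  shows "(\<integral>\<^sup>+ y. ennreal (acc \<pi> p x y * p y) \<partial>L) + rejection X \<pi> p x = 1"
proof -
  have "(\<integral>\<^sup>+ y\<in>X. ennreal (acc \<pi> p x y * p y) \<partial>L) = (\<integral>\<^sup>+ y. ennreal (acc \<pi> p x y * p y) \<partial>L)"
    by (intro nn_integral_cong) auto
  then show ?thesis
    using prob_space.emeasure_space_1[OF prob_space_imh_kernel[OF dens_target dens_prop assms]]
      emeasure_imh_kernel[OF dens_target dens_prop, of X x] assms sets.top[of L]
    by simp
qed

lemma measurable_rejection [measurable]: "rejection X \<pi> p \<in> borel_measurable L"
proof -
  interpret sigma_finite_measure L by (rule sigma_finite_L)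
  show ?thesis unfolding rejection_def acc_def by measurable
qed

text \<open>Fubini and detailed balance turn the accepted flow into \<open>A\<close> into the
  accepted flow out of \<open>A\<close>. Adding the rejected mass that stays in \<open>A\<close>
  restores \<open>\<pi>\<close> there, as acceptance and rejection probabilities sum to 1.\<close>

lemma stationary:
  assumes A[measurable]: "A \<in> sets L"
  shows "(\<integral>\<^sup>+ x. emeasure (K x) A \<partial>target) = emeasure target A"
proof -
  interpret L: sigma_finite_measure L by (rule sigma_finite_L)
  interpret pair_sigma_finite L L ..
  let ?k = "\<lambda>x y. ennreal (\<pi> x * (acc \<pi> p x y * p y))"
  have [measurable]: "(\<lambda>(x, y). ?k x y) \<in> borel_measurable (L \<Otimes>\<^sub>M L)"
    unfolding acc_def by measurable
  have [measurable]: "(\<lambda>x. emeasure (K x) A) \<in> borel_measurable L"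
    unfolding emeasure_imh_kernel[OF dens_target dens_prop A] rejection_def acc_def by measurable
  have "(\<integral>\<^sup>+ x. emeasure (K x) A \<partial>target) = (\<integral>\<^sup>+ x. ennreal (\<pi> x) * emeasure (K x) A \<partial>L)"
    by (rule nn_integral_target) measurable
  also have "\<dots> = (\<integral>\<^sup>+ x. (\<integral>\<^sup>+ y. ?k x y * indicator A y \<partial>L)
      + ennreal (\<pi> x) * rejection X \<pi> p x * indicator A x \<partial>L)"
  proof (rule nn_integral_cong)
    fix x assume "x \<in> space L"
    then have x: "x \<in> X" by simp
    have "ennreal (\<pi> x) * (\<integral>\<^sup>+ y\<in>A. ennreal (acc \<pi> p x y * p y) \<partial>L)
        = (\<integral>\<^sup>+ y. ennreal (\<pi> x) * (ennreal (acc \<pi> p x y * p y) * indicator A y) \<partial>L)"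
      by (rule nn_integral_cmult[symmetric]) measurable
    also have "\<dots> = (\<integral>\<^sup>+ y. ?k x y * indicator A y \<partial>L)"
      by (rule nn_integral_cong)
        (use x acc_bounds prop_nonneg target_nonneg in
          \<open>auto simp: ennreal_mult split: split_indicator\<close>)
    finally show "ennreal (\<pi> x) * emeasure (K x) A = (\<integral>\<^sup>+ y. ?k x y * indicator A y \<partial>L)
        + ennreal (\<pi> x) * rejection X \<pi> p x * indicator A x"
      by (simp add: emeasure_imh_kernel[OF dens_target dens_prop A] distrib_left mult.assoc)
  qed
  also have "\<dots> = (\<integral>\<^sup>+ x. (\<integral>\<^sup>+ y. ?k x y * indicator A y \<partial>L) \<partial>L)
      + (\<integral>\<^sup>+ x. ennreal (\<pi> x) * rejection X \<pi> p x * indicator A x \<partial>L)"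
    by (rule nn_integral_add) measurable
  also have "(\<integral>\<^sup>+ x. (\<integral>\<^sup>+ y. ?k x y * indicator A y \<partial>L) \<partial>L)
      = (\<integral>\<^sup>+ y. (\<integral>\<^sup>+ x. ?k x y * indicator A y \<partial>L) \<partial>L)"
    by (rule Fubini'[symmetric]) measurable
  also have "\<dots> = (\<integral>\<^sup>+ y. ennreal (\<pi> y) * (\<integral>\<^sup>+ x. ennreal (acc \<pi> p y x * p x) \<partial>L) * indicator A y \<partial>L)"
  proof (rule nn_integral_cong)
    fix y assume "y \<in> space L"
    then have y: "y \<in> X" by simp
    have "(\<integral>\<^sup>+ x. ?k x y * indicator A y \<partial>L)
        = (\<integral>\<^sup>+ x. (ennreal (\<pi> y) * indicator A y) * ennreal (acc \<pi> p y x * p x) \<partial>L)"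
      by (rule nn_integral_cong)
        (use y acc_bounds prop_nonneg target_nonneg in
          \<open>auto simp: detailed_balance[OF _ y] ennreal_mult split: split_indicator\<close>)
    also have "\<dots> = (ennreal (\<pi> y) * indicator A y) * (\<integral>\<^sup>+ x. ennreal (acc \<pi> p y x * p x) \<partial>L)"
      by (rule nn_integral_cmult) measurable
    finally show "(\<integral>\<^sup>+ x. ?k x y * indicator A y \<partial>L)
        = ennreal (\<pi> y) * (\<integral>\<^sup>+ x. ennreal (acc \<pi> p y x * p x) \<partial>L) * indicator A y"
      by (simp add: ac_simps)
  qed
  also have "(\<integral>\<^sup>+ y. ennreal (\<pi> y) * (\<integral>\<^sup>+ x. ennreal (acc \<pi> p y x * p x) \<partial>L) * indicator A y \<partial>L)
      + (\<integral>\<^sup>+ x. ennreal (\<pi> x) * rejection X \<pi> p x * indicator A x \<partial>L)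
      = (\<integral>\<^sup>+ x. ennreal (\<pi> x) * (\<integral>\<^sup>+ y. ennreal (acc \<pi> p x y * p y) \<partial>L) * indicator A x
          + ennreal (\<pi> x) * rejection X \<pi> p x * indicator A x \<partial>L)"
    unfolding acc_def by (rule nn_integral_add[symmetric]) measurable
  also have "\<dots> = (\<integral>\<^sup>+ x\<in>A. ennreal (\<pi> x) \<partial>L)"
    by (rule nn_integral_cong)
      (simp add: distrib_left[symmetric] distrib_right[symmetric] nn_integral_acc_plus_rejection)
  finally show ?thesis by (simp add: emeasure_target)
qed

section \<open>The \<open>n\<close>-step kernel and the upper bound\<close>

lemma measurable_K: "K \<in> L \<rightarrow>\<^sub>M subprob_algebra L"
  using measurable_prob_algebraD[OF measurable_imh_kernel[OF polish dens_target dens_prop]] .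

lemma measurable_Kn: "Kn n \<in> L \<rightarrow>\<^sub>M subprob_algebra L"
  using measurable_prob_algebraD[OF measurable_imh_power[OF polish dens_target dens_prop]] .

lemma measurable_emeasure_Kn:
  "A \<in> sets L \<Longrightarrow> (\<lambda>x. emeasure (Kn n x) A) \<in> borel_measurable L"
  using measurable_emeasure_subprob_algebra[of A L] measurable_Kn[of n] by measurable

lemma X_nonempty: "X \<noteq> {}"
  using prob_space.not_empty[OF prob_target] by simp

lemma target_bind_K: "target \<bind> K = target"
proof (rule measure_eqI)
  have K: "K \<in> target \<rightarrow>\<^sub>M subprob_algebra L"
    using measurable_K by (simp cong: measurable_cong_sets)
  show sets: "sets (target \<bind> K) = sets target"
    using X_nonempty by (subst sets_bind[of _ _ L]) auto
  show "emeasure (target \<bind> K) A = emeasure target A" if "A \<in> sets (target \<bind> K)" for A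
    using that sets K X_nonempty by (subst emeasure_bind[of _ _ L]) (auto intro: stationary)
qed

text \<open>Since \<open>kernel_power\<close> splits off the first step, the integral for
  \<open>Suc n\<close> is that of \<open>Kn n\<close> against \<open>target \<bind> K\<close>, which
  is \<open>target\<close> again.\<close>

lemma stationary_power:
  assumes A: "A \<in> sets L"
  shows "(\<integral>\<^sup>+ x. emeasure (Kn n x) A \<partial>target) = emeasure target A"
proof (induction n)
  case 0
  have "(\<integral>\<^sup>+ x. emeasure (Kn 0 x) A \<partial>target) = (\<integral>\<^sup>+ x. indicator A x \<partial>target)"
    by (rule nn_integral_cong) (simp add: imh_power_def A)
  then show ?case using A by simp
next
  case (Suc n)
  have K: "K \<in> target \<rightarrow>\<^sub>M subprob_algebra L"
    using measurable_K by (simp cong: measurable_cong_sets)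
  have "(\<integral>\<^sup>+ x. emeasure (Kn (Suc n) x) A \<partial>target)
      = (\<integral>\<^sup>+ x. \<integral>\<^sup>+ y. emeasure (Kn n y) A \<partial>K x \<partial>target)"
    by (rule nn_integral_cong)
      (use A in \<open>auto simp: emeasure_imh_power_Suc[OF polish dens_target dens_prop]\<close>)
  also have "\<dots> = (\<integral>\<^sup>+ y. emeasure (Kn n y) A \<partial>(target \<bind> K))"
    by (rule nn_integral_bind[symmetric, OF measurable_emeasure_Kn[OF A] K])
  finally show ?case using Suc.IH by (simp add: target_bind_K)
qed

text \<open>With \<open>q = 1 - 1 / wmax\<close>, the induction hypothesis bounds
  \<open>Kn n y A\<close> below by the constant \<open>c = (1 - q ^ n) * m\<close> on the support.
  One-step minorization is applied only to the nonnegative excess over \<open>c\<close>, whose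
  integral against \<open>target\<close> is \<open>m - c = q ^ n * m\<close> by stationarity. This
  yields \<open>(1 - q) * (m - c) + c = (1 - q ^ Suc n) * m\<close>.\<close>

lemma power_minorization:
  assumes "x \<in> supp X \<pi>" and A: "A \<in> sets L"
  shows "(1 - (1 - 1 / wmax) ^ n) * measure target A \<le> measure (Kn n x) A"
  using assms(1)
proof (induction n arbitrary: x)
  case 0
  then show ?case by simp
next
  case (Suc n)
  interpret T: prob_space target by (rule prob_target)
  define q where "q = 1 - 1 / wmax"
  have q: "0 \<le> q" "q \<le> 1" using wmax_ge_1 by (auto simp: q_def)
  define m where "m = measure target A"
  have m: "0 \<le> m" by (simp add: m_def)
  define c where "c = (1 - q ^ n) * m"
  have c: "0 \<le> c" using q m by (simp add: c_def power_le_one)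
  have x: "x \<in> X" using Suc.prems by (simp add: supp_def)
  interpret Kx: prob_space "K x" by (rule prob_space_imh_kernel[OF dens_target dens_prop x])
  let ?f = "\<lambda>y. emeasure (Kn n y) A"
  \<comment> \<open>Subtraction in \<open>ennreal\<close> truncates at 0, but on the support
    \<open>fc\<close> rules this out, and both \<open>target\<close> and \<open>K x\<close> are
    concentrated there; \<open>split\<close> uses exactly this.\<close>
  let ?g = "\<lambda>y. ?f y - ennreal c"
  note [measurable] = measurable_emeasure_Kn[OF A]
  have fc: "ennreal c \<le> ?f y" if "y \<in> supp X \<pi>" for y
  proof -
    interpret Ky: prob_space "Kn n y" using prob_Kn that by (auto simp: supp_def)
    show ?thesis using Suc.IH[OF that] c
      by (simp add: Ky.emeasure_eq_measure c_def q_def m_def)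
  qed
  have AE_T: "AE y in target. y \<in> supp X \<pi>"
    unfolding dens_measure_def by (subst AE_density) (auto simp: supp_def)
  have split: "(\<integral>\<^sup>+ y. ?f y \<partial>M) = (\<integral>\<^sup>+ y. ?g y \<partial>M) + ennreal c"
    if "prob_space M" "sets M = sets L" "AE y in M. y \<in> supp X \<pi>" for M
  proof -
    have [measurable_cong]: "sets M = sets L" by fact
    have "(\<integral>\<^sup>+ y. ?f y \<partial>M) = (\<integral>\<^sup>+ y. ?g y + ennreal c \<partial>M)"
      by (rule nn_integral_cong_AE)
        (use that(3) in \<open>eventually_elim, auto simp: fc diff_add_cancel_ennreal\<close>)
    also have "\<dots> = (\<integral>\<^sup>+ y. ?g y \<partial>M) + ennreal c"
      by (subst nn_integral_add) (auto simp: prob_space.emeasure_space_1[OF that(1)])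
    finally show ?thesis .
  qed
  have "(\<integral>\<^sup>+ y. ?g y \<partial>target) + ennreal c = ennreal m"
    using split[OF prob_target sets_target AE_T] stationary_power[OF A]
    by (simp add: m_def T.emeasure_eq_measure)
  then have g: "(\<integral>\<^sup>+ y. ?g y \<partial>target) = ennreal (m - c)"
    using c by (metis ennreal_add_diff_cancel_right ennreal_minus ennreal_neq_top)
  have "ennreal ((1 - q) * (m - c) + c) = ennreal (1 / wmax) * (\<integral>\<^sup>+ y. ?g y \<partial>target) + ennreal c"
  proof -
    have "m - c = q ^ n * m" by (simp add: c_def algebra_simps)
    then have "0 \<le> m - c" using q m by simp
    then show ?thesis using c q g by (simp add: q_def ennreal_mult[symmetric] ennreal_plus[symmetric] del: ennreal_plus)
  qed
  also have "\<dots> = (\<integral>\<^sup>+ y. ?g y \<partial>scale_measure (ennreal (1 / wmax)) target) + ennreal c"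
    by (subst nn_integral_scale_measure) auto
  also have "\<dots> \<le> (\<integral>\<^sup>+ y. ?g y \<partial>K x) + ennreal c"
    by (intro add_mono nn_integral_mono_measure minorization Suc.prems) auto
  also have "\<dots> = (\<integral>\<^sup>+ y. ?f y \<partial>K x)"
    by (rule split[symmetric, OF Kx.prob_space_axioms _ AE_K_supp[OF Suc.prems]]) simp
  also have "\<dots> = emeasure (Kn (Suc n) x) A"
    using emeasure_imh_power_Suc[OF polish dens_target dens_prop x A] by simp
  finally have "ennreal ((1 - q) * (m - c) + c) \<le> emeasure (Kn (Suc n) x) A" .
  moreover interpret Kx': prob_space "Kn (Suc n) x" by (rule prob_Kn[OF x])
  have "(1 - q) * (m - c) + c = (1 - q ^ Suc n) * m"
    by (simp add: c_def algebra_simps)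
  ultimately show ?case
    by (simp add: Kx'.emeasure_eq_measure m_def q_def)
qed

text \<open>The minorization leaves a deficit of at most
  \<open>(1 - 1 / wmax) ^ n * measure target A\<close>, and the last factor is at most 1.\<close>

lemma tv_upper:
  assumes "x \<in> supp X \<pi>"
  shows "tv_dist (Kn n x) target \<le> (1 - 1 / wmax) ^ n"
proof -
  interpret T: prob_space target by (rule prob_target)
  have x: "x \<in> X" using assms by (simp add: supp_def)
  show ?thesis
  proof (rule tv_dist_le_one_sided)
    fix A assume "A \<in> sets (Kn n x)"
    then have "(1 - (1 - 1 / wmax) ^ n) * measure target A \<le> measure (Kn n x) A"
      using power_minorization[OF assms] sets_Kn[OF x] by simp
    moreover have "(1 - 1 / wmax) ^ n * measure target A \<le> (1 - 1 / wmax) ^ n"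
      using wmax_ge_1 by (intro mult_left_le) auto
    ultimately show "measure target A - measure (Kn n x) A \<le> (1 - 1 / wmax) ^ n"
      by (simp add: algebra_simps)
  qed (use prob_Kn[OF x] prob_target sets_Kn[OF x] in auto)
qed

section \<open>The atom at the starting point and the lower bound\<close>

lemma singleton_sets: "x \<in> X \<Longrightarrow> {x} \<in> sets L"
  unfolding lebesgue_on_space_def
  using polish_subset_imp_borel[OF polish] by (subst sets_restrict_space_iff) auto

lemma target_singleton:
  assumes "x \<in> X"
  shows "measure target {x} = 0"
proof -
  have "emeasure L {x} = 0"
    unfolding lebesgue_on_space_def
    using polish_subset_imp_borel[OF polish] assms by (subst emeasure_restrict_space) auto
  then have "emeasure target {x} = 0"
    using singleton_sets[OF assms] unfolding dens_measure_def
    by (subst emeasure_density) (auto simp: nn_integral_indicator_singleton)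
  then show ?thesis by (simp add: measure_def)
qed

text \<open>The acceptance density is at most \<open>\<pi> y / w x\<close>, so the overall
  acceptance probability is at most \<open>1 / w x\<close>.\<close>

lemma rejection_ge:
  assumes "x \<in> supp X \<pi>"
  shows "ennreal (1 - 1 / w x) \<le> rejection X \<pi> p x"
proof -
  have x: "x \<in> X" "0 < w x" using assms in_supp_target_iff by auto
  have "(\<integral>\<^sup>+ y. ennreal (acc \<pi> p x y * p y) \<partial>L) \<le> (\<integral>\<^sup>+ y. ennreal (1 / w x) * ennreal (\<pi> y) \<partial>L)"
  proof (rule nn_integral_mono)
    fix y assume "y \<in> space L"
    then have y: "y \<in> X" by simp
    show "ennreal (acc \<pi> p x y * p y) \<le> ennreal (1 / w x) * ennreal (\<pi> y)"
      using acc_times_prop[OF x y] x target_nonneg[OF y]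
      by (simp add: ennreal_mult[symmetric] ennreal_leI)
  qed
  also have "\<dots> = ennreal (1 / w x)"
    by (simp add: nn_integral_cmult nn_integral_densities)
  finally have "1 \<le> ennreal (1 / w x) + rejection X \<pi> p x"
    using nn_integral_acc_plus_rejection[OF x(1)] by (metis add_right_mono)
  then have "1 - ennreal (1 / w x) \<le> rejection X \<pi> p x"
    by (simp add: ennreal_minus_le_iff)
  then show ?thesis using x by (simp add: ennreal_minus[symmetric])
qed

text \<open>Rejecting \<open>n\<close> times in a row is one way of being at \<open>x\<close> after
  \<open>n\<close> steps.\<close>

lemma rejection_power_le:
  assumes x: "x \<in> X"
  shows "rejection X \<pi> p x ^ n \<le> emeasure (Kn n x) {x}"
proof (induction n)
  case 0
  then show ?case using singleton_sets[OF x] by (simp add: imh_power_def)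
next
  case (Suc n)
  have s: "{x} \<in> sets (K x)" using singleton_sets[OF x] by simp
  have "rejection X \<pi> p x \<le> emeasure (K x) {x}"
    using emeasure_imh_kernel[OF dens_target dens_prop singleton_sets[OF x], of x] by simp
  then have "rejection X \<pi> p x ^ Suc n \<le> emeasure (Kn n x) {x} * emeasure (K x) {x}"
    using Suc.IH by (simp add: mult.commute mult_mono)
  \<comment> \<open>The product is the contribution of the paths whose first step stays at
    \<open>x\<close>.\<close>
  also have "\<dots> = (\<integral>\<^sup>+ y\<in>{x}. emeasure (Kn n y) {x} \<partial>K x)"
    using s by simp
  also have "\<dots> \<le> (\<integral>\<^sup>+ y. emeasure (Kn n y) {x} \<partial>K x)"
    by (rule nn_integral_mono) (auto split: split_indicator)
  also have "\<dots> = emeasure (Kn (Suc n) x) {x}"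
    using emeasure_imh_power_Suc[OF polish dens_target dens_prop x singleton_sets[OF x]] by simp
  finally show ?case .
qed

text \<open>The singleton of the starting point serves as test set, being null for
  \<open>target\<close>. Truncation at 0 is needed because \<open>w x < 1\<close> makes
  \<open>1 - 1 / w x\<close> negative, and powers are monotone only on nonnegative numbers.\<close>

lemma tv_lower:
  assumes "x \<in> supp X \<pi>"
  shows "max 0 (1 - 1 / w x) ^ n \<le> tv_dist (Kn n x) target"
proof -
  have x: "x \<in> X" using assms by (simp add: supp_def)
  interpret Kx: prob_space "Kn n x" by (rule prob_Kn[OF x])
  have "ennreal (max 0 (1 - 1 / w x)) \<le> rejection X \<pi> p x"
    using rejection_ge[OF assms] by (simp add: max_def)
  then have "ennreal (max 0 (1 - 1 / w x)) ^ n \<le> emeasure (Kn n x) {x}"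
    using rejection_power_le[OF x, of n] by (meson order_trans power_mono zero_le)
  then have "max 0 (1 - 1 / w x) ^ n \<le> measure (Kn n x) {x}"
    by (simp only: ennreal_power max.cobounded1 Kx.emeasure_eq_measure
        ennreal_le_iff[OF measure_nonneg])
  also have "\<dots> = \<bar>measure (Kn n x) {x} - measure target {x}\<bar>"
    using target_singleton[OF x] by simp
  also have "\<dots> \<le> tv_dist (Kn n x) target"
    using singleton_sets[OF x] sets_Kn[OF x]
    by (intro abs_measure_diff_le_tv_dist Kx.prob_space_axioms prob_target) auto
  finally show ?thesis .
qed

section \<open>The supremum over starting points\<close>

lemma weight_tendsto_wmax:
  obtains x where "\<And>k. x k \<in> supp X \<pi>" "(\<lambda>k. w (x k)) \<longlonglongrightarrow> wmax"
proof -
  have "\<exists>x\<in>supp X \<pi>. wmax - inverse (real (Suc k)) < w x" for k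
  proof -
    \<comment> \<open>The supremum is over \<open>supp X p\<close>, but the sequence must lie in
      \<open>supp X \<pi>\<close>; the truncation at 0 forces \<open>w x > 0\<close> and thus
      membership.\<close>
    define c where "c = max 0 (wmax - inverse (real (Suc k)))"
    have c: "c < wmax" using wmax_ge_1 by (auto simp: c_def)
    have "supp X p \<noteq> {}"
    proof
      assume "supp X p = {}"
      then have "(\<integral>\<^sup>+ x. ennreal (p x) \<partial>L) = (\<integral>\<^sup>+ x. 0 \<partial>L)"
        by (intro nn_integral_cong) (auto simp: supp_def intro: ennreal_neg leI)
      then show False by (simp add: nn_integral_densities)
    qed
    then obtain x where "x \<in> supp X p" "c < w x"
      using c less_cSUP_iff[OF _ bdd_weight] unfolding weight_sup_def by auto
    then show ?thesis
      using in_supp_target_iff[of x] by (intro bexI[of _ x]) (auto simp: c_def supp_def)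
  qed
  then obtain x where x: "\<And>k. x k \<in> supp X \<pi>" "\<And>k. wmax - inverse (real (Suc k)) < w (x k)"
    by metis
  have "(\<lambda>k. w (x k)) \<longlonglongrightarrow> wmax"
  proof (rule tendsto_sandwich)
    show "(\<lambda>k. wmax - inverse (real (Suc k))) \<longlonglongrightarrow> wmax"
      using tendsto_diff[OF tendsto_const LIMSEQ_inverse_real_of_nat] by simp
    show "\<forall>\<^sub>F k in sequentially. w (x k) \<le> wmax"
      using x(1) weight_le_wmax by (auto simp: in_supp_target_iff)
  qed (use x(2) in \<open>auto intro!: always_eventually less_imp_le\<close>)
  then show ?thesis using that x(1) by blast
qed

text \<open>The upper bound is uniform in the starting point. As the supremum of the weights need
  not be attained, the lower bound is passed to the limit along a maximizing sequence; the
  truncation disappears because \<open>wmax \<ge> 1\<close>.\<close>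

lemma SUP_tv_dist:
  "(SUP x\<in>supp X \<pi>. tv_dist (Kn n x) target) = (1 - 1 / wmax) ^ n"
proof (rule antisym)
  obtain x where x: "\<And>k. x k \<in> supp X \<pi>" "(\<lambda>k. w (x k)) \<longlonglongrightarrow> wmax"
    using weight_tendsto_wmax by blast
  show "(SUP x\<in>supp X \<pi>. tv_dist (Kn n x) target) \<le> (1 - 1 / wmax) ^ n"
    using x(1) by (intro cSUP_least tv_upper) auto
  have "max 0 (1 - 1 / w (x k)) ^ n \<le> (SUP x\<in>supp X \<pi>. tv_dist (Kn n x) target)" for k
  proof (rule order_trans[OF tv_lower[OF x(1)]])
    show "tv_dist (Kn n (x k)) target \<le> (SUP x\<in>supp X \<pi>. tv_dist (Kn n x) target)"
      by (rule cSUP_upper[OF x(1)]) (auto intro!: bdd_aboveI2 tv_upper)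
  qed
  moreover have "(\<lambda>k. max 0 (1 - 1 / w (x k)) ^ n) \<longlonglongrightarrow> max 0 (1 - 1 / wmax) ^ n"
    using wmax_ge_1 by (intro tendsto_intros x(2)) auto
  ultimately have "max 0 (1 - 1 / wmax) ^ n \<le> (SUP x\<in>supp X \<pi>. tv_dist (Kn n x) target)"
    by (intro LIMSEQ_le_const2) auto
  then show "(1 - 1 / wmax) ^ n \<le> (SUP x\<in>supp X \<pi>. tv_dist (Kn n x) target)"
    using wmax_ge_1 by (simp add: max_def split: if_splits)
qed

text \<open>A maximizer has positive weight since \<open>wmax \<ge> 1\<close>, so it lies in the
  support, and there the upper and lower bounds coincide.\<close>

lemma tv_dist_at_max:
  assumes "x \<in> X" "w x = wmax"
  shows "tv_dist (Kn n x) target = (1 - 1 / wmax) ^ n"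
proof -
  have "x \<in> supp X \<pi>" using assms wmax_ge_1 by (simp add: in_supp_target_iff)
  then show ?thesis
    using tv_upper[of x n] tv_lower[of x n] assms(2) wmax_ge_1
    by (simp add: max_def split: if_splits)
qed

end

theorem theorem2:
  fixes X :: "'a::euclidean_space set" and \<pi> p :: "'a \<Rightarrow> real"
  assumes "polish_subset X"
    and "continuous_density X \<pi>" and "continuous_density X p"
    and "supp X \<pi> \<subseteq> supp X p"
    and "bdd_above (weight \<pi> p ` supp X p)"
  shows "(\<forall>n\<ge>1. (SUP x\<in>supp X \<pi>. tv_dist (imh_power X \<pi> p n x) (dens_measure X \<pi>))
              = (1 - 1 / weight_sup X \<pi> p) ^ n)
       \<and> (\<forall>x'\<in>X. weight \<pi> p x' = weight_sup X \<pi> p \<longrightarrow>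
            (\<forall>n\<ge>1. (SUP x\<in>supp X \<pi>. tv_dist (imh_power X \<pi> p n x) (dens_measure X \<pi>))
                      = tv_dist (imh_power X \<pi> p n x') (dens_measure X \<pi>)
                  \<and> tv_dist (imh_power X \<pi> p n x') (dens_measure X \<pi>)
                      = (1 - 1 / weight_sup X \<pi> p) ^ n))"
proof -
  interpret imh X \<pi> p by standard (fact assms)+
  show ?thesis by (simp add: SUP_tv_dist tv_dist_at_max)
qed

end
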